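(* Let $\mathcal{A}$ be a category of algebras and let $\mathcal{K}$ be a congruences presheaf over $\mathcal{A}$. Then for each $A\in\mathcal{A}$ the following conditions are equivalent: 1. $A$ has the $CBS_{\mathcal{K}}$-property. 2. If $\theta\in\mathcal{K}(A)$ and $A\cong A/\theta$, then for all $\sigma\in\mathcal{K}(A)$ such that $\sigma\subseteq\theta$ we have $A\cong A/\sigma$.
   Context: A category of algebras $\mathcal{A}$ has as objects algebras of one fixed type $\tau$ and as morphisms all $\tau$-homomorphisms between its objects; $A\in\mathcal{A}$ means $A$ is an object of $\mathcal{A}$, and $\cong$ means $\tau$-isomorphic. $Con(A)$ is the congruence lattice of $A$, with least element $\Delta_A$ (the diagonal) and greatest element $\nabla_A=A^2$. For $\sigma\in Con(A)$ and $\theta$ in the interval $[\sigma,\nabla_A]$ of $Con(A)$, put $\theta/\sigma=\{(x_\sigma,y_\sigma)\in (A/\sigma)^2:(x,y)\in\theta\}\in Con(A/\sigma)$, where $x_\sigma$ is the $\sigma$-class of $x$. For a homomorphism $f:A\to B$ and $\theta\in Con(B)$ put $f^*(\theta)=\{(a,b)\in A^2:(f(a),f(b))\in\theta\}\in Con(A)$. A congruences operator over $\mathcal{A}$ is an assignment $\mathcal{A}\ni A\mapsto\mathcal{K}(A)\subseteq Con(A)$ such that (i) $\Delta_A\in\mathcal{K}(A)$; (ii) $A/\sigma\in\mathcal{A}$ for each $\sigma\in\mathcal{K}(A)$; (iii) for each isomorphism $f:A\to B$ in $\mathcal{A}$, the restriction of $f^*$ to $\mathcal{K}(B)$ is an order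 isomorphism $\mathcal{K}(B)\to\mathcal{K}(A)$ (sets ordered by inclusion). A congruences presheaf over $\mathcal{A}$ is a congruences operator $\mathcal{K}$ such that for all $A\in\mathcal{A}$, $\sigma\in\mathcal{K}(A)$ and $\theta\in[\sigma,\nabla_A]$: $\theta\in\mathcal{K}(A)$ if and only if $\theta/\sigma\in\mathcal{K}(A/\sigma)$. $A\in\mathcal{A}$ has the $CBS_{\mathcal{K}}$-property iff: for every $B\in\mathcal{A}$, $\theta_B\in\mathcal{K}(B)$ and $\theta_A\in\mathcal{K}(A)$ with $A\cong B/\theta_B$ and $B\cong A/\theta_A$, one has $A\cong B$. *)

theory Defs
  imports "HOL-Algebra.Congruence"
begin

text \<open>
  A type assigns finite arities to a set of operation symbols. It is a partial map, so the set of
  operation symbols is an arbitrary (possibly empty) subset of the HOL type \<open>'f\<close>.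
\<close>

type_synonym 'f sim_type = "'f \<Rightarrow> nat option"

record ('a, 'f) alg = "'a partial_object" +
  op :: "'f \<Rightarrow> 'a list \<Rightarrow> 'a"

definition tuples :: "nat \<Rightarrow> 'a set \<Rightarrow> 'a list set" where
  "tuples n X = {xs. length xs = n \<and> set xs \<subseteq> X}"

text \<open>
  The extensionality conditions make HOL equality of algebras coincide with equality of
  carriers and basic operations. Algebras with empty carrier are not excluded.
\<close>

definition algebra :: "'f sim_type \<Rightarrow> ('a, 'f) alg \<Rightarrow> bool" where
  "algebra \<tau> A \<longleftrightarrow>
     (\<forall>f n. \<tau> f = Some n \<longrightarrow> op A f \<in> tuples n (carrier A) \<rightarrow>\<^sub>E carrier A) \<and>
     (\<forall>f. \<tau> f = None \<longrightarrow> op A f = (\<lambda>_. undefined))"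

definition homs :: "'f sim_type \<Rightarrow> ('a, 'f) alg \<Rightarrow> ('b, 'f) alg \<Rightarrow> ('a \<Rightarrow> 'b) set" where
  "homs \<tau> A B = {h \<in> carrier A \<rightarrow> carrier B.
     \<forall>f n. \<tau> f = Some n \<longrightarrow>
       (\<forall>xs \<in> tuples n (carrier A). h (op A f xs) = op B f (map h xs))}"

definition isos :: "'f sim_type \<Rightarrow> ('a, 'f) alg \<Rightarrow> ('b, 'f) alg \<Rightarrow> ('a \<Rightarrow> 'b) set" where
  "isos \<tau> A B = {h \<in> homs \<tau> A B. bij_betw h (carrier A) (carrier B)}"

definition isomorphic :: "'f sim_type \<Rightarrow> ('a, 'f) alg \<Rightarrow> ('b, 'f) alg \<Rightarrow> bool" where
  "isomorphic \<tau> A B \<longleftrightarrow> isos \<tau> A B \<noteq> {}"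

definition Con :: "'f sim_type \<Rightarrow> ('a, 'f) alg \<Rightarrow> 'a rel set" where
  "Con \<tau> A = {\<theta>. equiv (carrier A) \<theta> \<and>
     (\<forall>f n. \<tau> f = Some n \<longrightarrow>
       (\<forall>xs \<in> tuples n (carrier A). \<forall>ys \<in> tuples n (carrier A).
          list_all2 (\<lambda>x y. (x, y) \<in> \<theta>) xs ys \<longrightarrow> (op A f xs, op A f ys) \<in> \<theta>))}"

text \<open>
  The class of \<open>x\<close> modulo \<open>\<sigma>\<close> is \<open>\<sigma> `` {x}\<close>, which has type \<open>'a set\<close>. A category of algebras contains
  algebras together with quotients of them, hence quotients must again be algebras over \<open>'a\<close>.
  We therefore fix a map \<open>el :: 'a set \<Rightarrow> 'a\<close> by which a class is regarded as an element of the
  universe \<open>'a\<close> (in set theory, where a class is a set and so itself an element, \<open>el\<close> is the identity).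
  All that is needed of \<open>el\<close> is that it keeps apart distinct classes of one congruence.
\<close>

definition qclass :: "('a set \<Rightarrow> 'a) \<Rightarrow> 'a rel \<Rightarrow> 'a \<Rightarrow> 'a" where
  "qclass el \<sigma> x = el (\<sigma> `` {x})"

definition quot :: "('a set \<Rightarrow> 'a) \<Rightarrow> 'f sim_type \<Rightarrow> ('a, 'f) alg \<Rightarrow> 'a rel \<Rightarrow> ('a, 'f) alg" where
  "quot el \<tau> A \<sigma> =
     \<lparr>carrier = qclass el \<sigma> ` carrier A,
      op = (\<lambda>f. case \<tau> f of
              None \<Rightarrow> (\<lambda>_. undefined)
            | Some n \<Rightarrow>
                (\<lambda>cs \<in> tuples n (qclass el \<sigma> ` carrier A).
                   qclass el \<sigma> (op A f (map (inv_into (carrier A) (qclass el \<sigma>)) cs))))\<rparr>"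

definition faithful_classes ::
    "('a set \<Rightarrow> 'a) \<Rightarrow> 'f sim_type \<Rightarrow> ('a, 'f) alg set \<Rightarrow> bool" where
  "faithful_classes el \<tau> \<A> \<longleftrightarrow> (\<forall>A \<in> \<A>. \<forall>\<sigma> \<in> Con \<tau> A. inj_on el (carrier A // \<sigma>))"

text \<open>The requirement on \<open>el\<close> can be met over every type and for every \<open>\<A>\<close>.\<close>

lemma ex_faithful_classes:
  "\<exists>el :: 'a set \<Rightarrow> 'a. \<forall>\<tau> (\<A> :: ('a, 'f) alg set). faithful_classes el \<tau> \<A>"
proof (intro exI allI)
  fix \<tau> and \<A> :: "('a, 'f) alg set"
  let ?el = "\<lambda>X :: 'a set. SOME x. x \<in> X"
  have "X = Y" if c: "equiv C \<sigma>" "X \<in> C // \<sigma>" "Y \<in> C // \<sigma>" "?el X = ?el Y" for C \<sigma> X Y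
  proof -
    have "X \<noteq> {}" "Y \<noteq> {}"
      using c in_quotient_imp_non_empty by metis+
    then have "?el X \<in> X" "?el Y \<in> Y"
      by (simp_all add: some_in_eq)
    then show ?thesis
      using quotient_disj[OF c(1-3)] c(4) by auto
  qed
  then show "faithful_classes ?el \<tau> \<A>"
    unfolding faithful_classes_def Con_def inj_on_def by blast
qed

text \<open>The operations of the quotient do not depend on the representatives chosen in its definition.\<close>

lemma quot_op:
  assumes A: "algebra \<tau> A" and \<sigma>: "\<sigma> \<in> Con \<tau> A" and el: "inj_on el (carrier A // \<sigma>)"
    and f: "\<tau> f = Some n" and xs: "xs \<in> tuples n (carrier A)"
  shows "op (quot el \<tau> A \<sigma>) f (map (qclass el \<sigma>) xs) = qclass el \<sigma> (op A f xs)"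
proof -
  let ?q = "qclass el \<sigma>" and ?r = "inv_into (carrier A) (qclass el \<sigma>)"
  have eq: "equiv (carrier A) \<sigma>"
    using \<sigma> by (simp add: Con_def)
  have r: "?r (?q x) \<in> carrier A \<and> (?r (?q x), x) \<in> \<sigma>" if "x \<in> carrier A" for x
  proof -
    have rx: "?r (?q x) \<in> carrier A" "?q (?r (?q x)) = ?q x"
      using that by (auto intro: inv_into_into f_inv_into_f)
    then have "\<sigma> `` {?r (?q x)} = \<sigma> `` {x}"
      using that inj_onD[OF el] by (simp add: qclass_def quotientI)
    then show ?thesis
      using rx that eq_equiv_class_iff[OF eq] by simp
  qed
  have ys: "map (?r \<circ> ?q) xs \<in> tuples n (carrier A)"
    using xs r by (auto simp: tuples_def)
  have "list_all2 (\<lambda>x y. (x, y) \<in> \<sigma>) (map (?r \<circ> ?q) xs) xs"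
    using xs r by (auto simp: tuples_def list_all2_conv_all_nth subset_iff)
  then have "(op A f (map (?r \<circ> ?q) xs), op A f xs) \<in> \<sigma>"
    using \<sigma> f xs ys by (auto simp: Con_def)
  then have "?q (op A f (map (?r \<circ> ?q) xs)) = ?q (op A f xs)"
    using equiv_class_eq[OF eq] by (simp add: qclass_def)
  moreover have "map ?q xs \<in> tuples n (?q ` carrier A)"
    using xs by (auto simp: tuples_def)
  ultimately show ?thesis
    using f by (simp add: quot_def comp_def)
qed

text \<open>The congruence \<open>\<theta>/\<sigma>\<close> of \<open>quot el \<tau> A \<sigma>\<close>\<close>

definition con_quot :: "('a set \<Rightarrow> 'a) \<Rightarrow> 'a rel \<Rightarrow> 'a rel \<Rightarrow> 'a rel" where
  "con_quot el \<theta> \<sigma> = {(qclass el \<sigma> x, qclass el \<sigma> y) | x y. (x, y) \<in> \<theta>}"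

text \<open>\<open>f\<^sup>*(\<theta>)\<close> for \<open>f\<close> with domain \<open>A\<close>\<close>

definition pullback :: "('a, 'f) alg \<Rightarrow> ('a \<Rightarrow> 'b) \<Rightarrow> 'b rel \<Rightarrow> 'a rel" where
  "pullback A f \<theta> = {(a, b) \<in> carrier A \<times> carrier A. (f a, f b) \<in> \<theta>}"

definition order_iso :: "('a set \<Rightarrow> 'b set) \<Rightarrow> 'a set set \<Rightarrow> 'b set set \<Rightarrow> bool" where
  "order_iso \<phi> P Q \<longleftrightarrow> bij_betw \<phi> P Q \<and> (\<forall>X \<in> P. \<forall>Y \<in> P. X \<subseteq> Y \<longleftrightarrow> \<phi> X \<subseteq> \<phi> Y)"

text \<open>
  The morphisms of a category of algebras are all homomorphisms between its objects, so the
  category is given by its set of objects.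
\<close>

definition category_of_algebras :: "'f sim_type \<Rightarrow> ('a, 'f) alg set \<Rightarrow> bool" where
  "category_of_algebras \<tau> \<A> \<longleftrightarrow> (\<forall>A \<in> \<A>. algebra \<tau> A)"

definition congruences_operator ::
    "('a set \<Rightarrow> 'a) \<Rightarrow> 'f sim_type \<Rightarrow> ('a, 'f) alg set \<Rightarrow> (('a, 'f) alg \<Rightarrow> 'a rel set) \<Rightarrow> bool" where
  "congruences_operator el \<tau> \<A> \<K> \<longleftrightarrow>
     (\<forall>A \<in> \<A>. \<K> A \<subseteq> Con \<tau> A) \<and>
     (\<forall>A \<in> \<A>. Id_on (carrier A) \<in> \<K> A) \<and>
     (\<forall>A \<in> \<A>. \<forall>\<sigma> \<in> \<K> A. quot el \<tau> A \<sigma> \<in> \<A>) \<and>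
     (\<forall>A \<in> \<A>. \<forall>B \<in> \<A>. \<forall>f \<in> isos \<tau> A B. order_iso (pullback A f) (\<K> B) (\<K> A))"

definition congruences_presheaf ::
    "('a set \<Rightarrow> 'a) \<Rightarrow> 'f sim_type \<Rightarrow> ('a, 'f) alg set \<Rightarrow> (('a, 'f) alg \<Rightarrow> 'a rel set) \<Rightarrow> bool" where
  "congruences_presheaf el \<tau> \<A> \<K> \<longleftrightarrow>
     congruences_operator el \<tau> \<A> \<K> \<and>
     (\<forall>A \<in> \<A>. \<forall>\<sigma> \<in> \<K> A. \<forall>\<theta> \<in> Con \<tau> A. \<sigma> \<subseteq> \<theta> \<longrightarrow>
        (\<theta> \<in> \<K> A \<longleftrightarrow> con_quot el \<theta> \<sigma> \<in> \<K> (quot el \<tau> A \<sigma>)))"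

definition CBS_property ::
    "('a set \<Rightarrow> 'a) \<Rightarrow> 'f sim_type \<Rightarrow> ('a, 'f) alg set \<Rightarrow> (('a, 'f) alg \<Rightarrow> 'a rel set) \<Rightarrow>
     ('a, 'f) alg \<Rightarrow> bool" where
  "CBS_property el \<tau> \<A> \<K> A \<longleftrightarrow>
     (\<forall>B \<in> \<A>. \<forall>\<theta>\<^sub>B \<in> \<K> B. \<forall>\<theta>\<^sub>A \<in> \<K> A.
        isomorphic \<tau> A (quot el \<tau> B \<theta>\<^sub>B) \<and> isomorphic \<tau> B (quot el \<tau> A \<theta>\<^sub>A) \<longrightarrow>
        isomorphic \<tau> A B)"

end

theory Submission
  imports Defs
begin

text \<open>
  Two images of one algebra under surjective homomorphisms with the same kernel are isomorphic; this
  is the homomorphism theorem in a form that treats the two images alike, and the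
  isomorphisms between quotients below are instances of it.

  Assume the CBS property, and let \<open>A \<cong> A/\<theta>\<close> and \<open>\<sigma> \<subseteq> \<theta>\<close>, with \<open>\<theta>\<close> and \<open>\<sigma>\<close> in \<open>\<K> A\<close>. The algebra
  \<open>B = A/\<sigma>\<close> is a quotient of \<open>A\<close>, and \<open>A\<close> is in turn a quotient of \<open>B\<close>, since
  \<open>A \<cong> A/\<theta> \<cong> (A/\<sigma>)/(\<theta>/\<sigma>)\<close>. The presheaf condition puts \<open>\<theta>/\<sigma>\<close> into \<open>\<K> B\<close>, so the CBS property applies
  and yields \<open>A \<cong> A/\<sigma>\<close>.

  Conversely, let \<open>A \<cong> B/\<theta>\<^sub>B\<close> and \<open>g : A/\<theta>\<^sub>A \<cong> B\<close>. Pulling \<open>\<theta>\<^sub>B\<close> back along \<open>g\<close> gives a member of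
  \<open>\<K> (A/\<theta>\<^sub>A)\<close>. By the correspondence between the congruences of \<open>A/\<theta>\<^sub>A\<close> and those of \<open>A\<close> above
  \<open>\<theta>\<^sub>A\<close> it has the form \<open>\<theta>/\<theta>\<^sub>A\<close>, and the presheaf condition, in the other direction, gives
  \<open>\<theta> \<in> \<K> A\<close>. The composite \<open>A \<rightarrow> A/\<theta>\<^sub>A \<rightarrow> B \<rightarrow> B/\<theta>\<^sub>B\<close> is onto with kernel \<open>\<theta>\<close>, so
  \<open>A/\<theta> \<cong> B/\<theta>\<^sub>B \<cong> A\<close>, and the second condition applied to \<open>\<theta>\<^sub>A \<subseteq> \<theta>\<close> yields \<open>A \<cong> A/\<theta>\<^sub>A \<cong> B\<close>.
\<close>

lemma map_tuples: "xs \<in> tuples n X \<Longrightarrow> h \<in> X \<rightarrow> Y \<Longrightarrow> map h xs \<in> tuples n Y"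
  by (auto simp: tuples_def)

lemma algebra_op_closed:
  "algebra \<tau> A \<Longrightarrow> \<tau> f = Some n \<Longrightarrow> xs \<in> tuples n (carrier A) \<Longrightarrow> op A f xs \<in> carrier A"
  by (auto simp: algebra_def)

lemma homs_carrier: "h \<in> homs \<tau> A B \<Longrightarrow> h \<in> carrier A \<rightarrow> carrier B"
  by (simp add: homs_def)

lemma homs_op:
  "h \<in> homs \<tau> A B \<Longrightarrow> \<tau> f = Some n \<Longrightarrow> xs \<in> tuples n (carrier A) \<Longrightarrow>
    h (op A f xs) = op B f (map h xs)"
  by (simp add: homs_def)

lemma homs_id: "id \<in> homs \<tau> A A"
  by (simp add: homs_def)

lemma homs_comp:
  assumes "h \<in> homs \<tau> A B" and "k \<in> homs \<tau> B C"
  shows "k \<circ> h \<in> homs \<tau> A C"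
  using assms map_tuples[OF _ homs_carrier[OF assms(1)]]
  by (auto simp: homs_def Pi_iff)

section \<open>Isomorphism of images with the same kernel\<close>

text \<open>
  Lifting an element of \<open>P\<close> along \<open>p\<close> and applying \<open>h\<close> does not depend on the lift, because \<open>p\<close>
  identifies no more than \<open>h\<close> does; the induced map is injective because it identifies no less.
\<close>

lemma isomorphic_images:
  assumes A: "algebra \<tau> A"
    and p: "p \<in> homs \<tau> A P" "p ` carrier A = carrier P"
    and h: "h \<in> homs \<tau> A B" "h ` carrier A = carrier B"
    and ker: "\<And>x y. x \<in> carrier A \<Longrightarrow> y \<in> carrier A \<Longrightarrow> p x = p y \<longleftrightarrow> h x = h y"
  shows "isomorphic \<tau> P B"
proof -
  define \<phi> where "\<phi> = h \<circ> inv_into (carrier A) p"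
  have \<phi>: "\<phi> (p x) = h x" if "x \<in> carrier A" for x
    using that ker[of "inv_into (carrier A) p (p x)" x]
    by (simp add: \<phi>_def inv_into_into f_inv_into_f)
  have "inj_on \<phi> (p ` carrier A)"
    by (auto intro!: inj_onI simp: \<phi> ker)
  moreover have "\<phi> ` p ` carrier A = h ` carrier A"
    by (simp add: image_image \<phi>)
  ultimately have bij: "bij_betw \<phi> (carrier P) (carrier B)"
    using p(2) h(2) by (simp add: bij_betw_def)
  have "\<phi> (op P f ys) = op B f (map \<phi> ys)"
    if f: "\<tau> f = Some n" and ys: "ys \<in> tuples n (carrier P)" for f n ys
  proof -
    have "ys \<in> lists (p ` carrier A)"
      using ys p(2) by (simp add: tuples_def lists_eq_set)
    then obtain xs where xs: "set xs \<subseteq> carrier A" "ys = map p xs"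
      unfolding lists_image by (auto simp: lists_eq_set)
    then have xs_tup: "xs \<in> tuples n (carrier A)"
      using ys by (simp add: tuples_def)
    have "\<phi> (op P f ys) = h (op A f xs)"
      using homs_op[OF p(1) f xs_tup] \<phi>[OF algebra_op_closed[OF A f xs_tup]] xs(2) by simp
    also have "\<dots> = op B f (map h xs)"
      by (rule homs_op[OF h(1) f xs_tup])
    also have "map h xs = map \<phi> ys"
      using xs \<phi> by auto
    finally show ?thesis .
  qed
  then have "\<phi> \<in> isos \<tau> P B"
    using bij bij_betwE[OF bij] by (auto simp: isos_def homs_def)
  then show ?thesis
    by (auto simp: isomorphic_def)
qed

lemma isomorphic_refl: "isomorphic \<tau> A A"
  using homs_id[of \<tau> A] by (auto simp: isomorphic_def isos_def)

text \<open>
  An isomorphism \<open>A \<rightarrow> B\<close> and the identity of \<open>A\<close> both have trivial kernel, so \<open>B\<close> and \<open>A\<close> are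
  images of \<open>A\<close> with the same kernel.
\<close>

lemma isomorphic_sym:
  assumes "algebra \<tau> A" and "isomorphic \<tau> A B"
  shows "isomorphic \<tau> B A"
proof -
  obtain h where h: "h \<in> homs \<tau> A B" "bij_betw h (carrier A) (carrier B)"
    using assms(2) by (auto simp: isomorphic_def isos_def)
  then have "h x = h y \<longleftrightarrow> id x = id y" if "x \<in> carrier A" "y \<in> carrier A" for x y
    using that by (auto simp: bij_betw_def dest: inj_onD)
  with h show ?thesis
    by (intro isomorphic_images[OF assms(1) h(1) _ homs_id]) (auto simp: bij_betw_def)
qed

lemma isomorphic_trans: "isomorphic \<tau> A B \<Longrightarrow> isomorphic \<tau> B C \<Longrightarrow> isomorphic \<tau> A C"
  unfolding isomorphic_def isos_def by (blast intro: homs_comp bij_betw_trans)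

section \<open>Projections onto quotients\<close>

lemma carrier_quot: "carrier (quot el \<tau> A \<sigma>) = qclass el \<sigma> ` carrier A"
  by (simp add: quot_def)

lemma qclass_eq_iff:
  assumes "\<sigma> \<in> Con \<tau> A" and "inj_on el (carrier A // \<sigma>)"
    and "x \<in> carrier A" and "y \<in> carrier A"
  shows "qclass el \<sigma> x = qclass el \<sigma> y \<longleftrightarrow> (x, y) \<in> \<sigma>"
  using assms eq_equiv_class_iff[of "carrier A" \<sigma> x y]
  by (auto simp: Con_def qclass_def inj_on_eq_iff quotientI)

lemma qclass_hom:
  assumes "algebra \<tau> A" and "\<sigma> \<in> Con \<tau> A" and "inj_on el (carrier A // \<sigma>)"
  shows "qclass el \<sigma> \<in> homs \<tau> A (quot el \<tau> A \<sigma>)"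
  using quot_op[OF assms] by (auto simp: homs_def carrier_quot)

lemma isomorphic_quot_image:
  assumes A: "algebra \<tau> A" and \<theta>: "\<theta> \<in> Con \<tau> A" and el: "inj_on el (carrier A // \<theta>)"
    and h: "h \<in> homs \<tau> A B" "h ` carrier A = carrier B"
    and ker: "\<And>x y. x \<in> carrier A \<Longrightarrow> y \<in> carrier A \<Longrightarrow> h x = h y \<longleftrightarrow> (x, y) \<in> \<theta>"
  shows "isomorphic \<tau> (quot el \<tau> A \<theta>) B"
  using isomorphic_images[OF A qclass_hom[OF A \<theta> el] _ h]
  by (simp add: carrier_quot qclass_eq_iff[OF \<theta> el] ker)

section \<open>Correspondence of congruences\<close>

lemma pullback_Con:
  assumes h: "h \<in> homs \<tau> A B" and A: "algebra \<tau> A" and \<psi>: "\<psi> \<in> Con \<tau> B"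
  shows "pullback A h \<psi> \<in> Con \<tau> A"
proof -
  have eq: "equiv (carrier B) \<psi>"
    using \<psi> by (simp add: Con_def)
  have hc: "h x \<in> carrier B" if "x \<in> carrier A" for x
    using homs_carrier[OF h] that by auto
  have "equiv (carrier A) (pullback A h \<psi>)"
  proof (rule equivI)
    show "pullback A h \<psi> \<subseteq> carrier A \<times> carrier A"
      by (auto simp: pullback_def)
    show "refl_on (carrier A) (pullback A h \<psi>)"
      using eq hc by (auto simp: pullback_def refl_on_def equiv_def)
    show "sym (pullback A h \<psi>)"
      using eq by (auto simp: pullback_def equiv_def sym_def)
    show "trans (pullback A h \<psi>)"
      using eq by (auto simp: pullback_def equiv_def intro!: transI dest: transD)
  qed
  moreover have "(op A f xs, op A f ys) \<in> pullback A h \<psi>"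
    if f: "\<tau> f = Some n" and xs: "xs \<in> tuples n (carrier A)" and ys: "ys \<in> tuples n (carrier A)"
      and rel: "list_all2 (\<lambda>x y. (x, y) \<in> pullback A h \<psi>) xs ys" for f n xs ys
  proof -
    have "list_all2 (\<lambda>x y. (x, y) \<in> \<psi>) (map h xs) (map h ys)"
      using rel by (auto simp: pullback_def list_all2_conv_all_nth)
    then have "(op B f (map h xs), op B f (map h ys)) \<in> \<psi>"
      using \<psi> f map_tuples[OF xs homs_carrier[OF h]] map_tuples[OF ys homs_carrier[OF h]]
      by (auto simp: Con_def)
    then show ?thesis
      using homs_op[OF h f xs] homs_op[OF h f ys]
        algebra_op_closed[OF A f xs] algebra_op_closed[OF A f ys]
      by (simp add: pullback_def)
  qed
  ultimately show ?thesis
    by (auto simp: Con_def)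
qed

text \<open>
  Every congruence of a quotient thus arises as some \<open>\<theta>/\<sigma>\<close>, and the two lemmas above and below
  this one show that \<open>\<theta>\<close> can be chosen as a congruence that contains \<open>\<sigma>\<close>, as the presheaf
  condition requires.
\<close>

lemma con_quot_pullback:
  assumes "\<psi> \<in> Con \<tau> (quot el \<tau> A \<sigma>)"
  shows "con_quot el (pullback A (qclass el \<sigma>) \<psi>) \<sigma> = \<psi>"
proof -
  have "\<psi> \<subseteq> qclass el \<sigma> ` carrier A \<times> qclass el \<sigma> ` carrier A"
    using assms by (auto simp: Con_def equiv_def carrier_quot)
  then show ?thesis
    by (fastforce simp: con_quot_def pullback_def)
qed

lemma subset_pullback_qclass:
  assumes \<sigma>: "\<sigma> \<in> Con \<tau> A" and el: "inj_on el (carrier A // \<sigma>)"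
    and \<psi>: "\<psi> \<in> Con \<tau> (quot el \<tau> A \<sigma>)"
  shows "\<sigma> \<subseteq> pullback A (qclass el \<sigma>) \<psi>"
proof (rule subrelI)
  fix x y assume xy: "(x, y) \<in> \<sigma>"
  then have c: "x \<in> carrier A" "y \<in> carrier A"
    using \<sigma> by (auto simp: Con_def equiv_def)
  have "(qclass el \<sigma> x, qclass el \<sigma> x) \<in> \<psi>"
    using \<psi> c by (auto simp: Con_def equiv_def refl_on_def carrier_quot)
  then show "(x, y) \<in> pullback A (qclass el \<sigma>) \<psi>"
    using c xy qclass_eq_iff[OF \<sigma> el c] by (simp add: pullback_def)
qed

text \<open>
  The pairs of classes in \<open>\<theta>/\<sigma>\<close> are given by representatives, and changing these moves them
  within \<open>\<sigma>\<close>. Since \<open>\<sigma> \<subseteq> \<theta>\<close>, this does not affect membership in \<open>\<theta>\<close>; hence \<open>\<theta>\<close> is the kernel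
  of the iterated projection \<open>A \<rightarrow> A/\<sigma> \<rightarrow> (A/\<sigma>)/(\<theta>/\<sigma>)\<close>.
\<close>

lemma con_quot_iff:
  assumes \<sigma>: "\<sigma> \<in> Con \<tau> A" and el: "inj_on el (carrier A // \<sigma>)"
    and \<theta>: "\<theta> \<in> Con \<tau> A" and sub: "\<sigma> \<subseteq> \<theta>"
    and c: "x \<in> carrier A" "y \<in> carrier A"
  shows "(qclass el \<sigma> x, qclass el \<sigma> y) \<in> con_quot el \<theta> \<sigma> \<longleftrightarrow> (x, y) \<in> \<theta>"
proof
  assume "(qclass el \<sigma> x, qclass el \<sigma> y) \<in> con_quot el \<theta> \<sigma>"
  then obtain u v where uv: "qclass el \<sigma> x = qclass el \<sigma> u" "qclass el \<sigma> v = qclass el \<sigma> y"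
      "(u, v) \<in> \<theta>"
    by (auto simp: con_quot_def)
  moreover have tr: "trans \<theta>" and "u \<in> carrier A" "v \<in> carrier A"
    using uv(3) \<theta> by (auto simp: Con_def equiv_def)
  ultimately have "(x, u) \<in> \<theta>" "(v, y) \<in> \<theta>"
    using qclass_eq_iff[OF \<sigma> el] c sub by blast+
  with uv(3) tr show "(x, y) \<in> \<theta>"
    by (meson transD)
qed (auto simp: con_quot_def)

section \<open>The Cantor-Bernstein-Schroeder property\<close>

theorem theorem2p11:
  fixes \<tau> :: "'f sim_type" and el :: "'a set \<Rightarrow> 'a"
    and \<A> :: "('a, 'f) alg set" and \<K> :: "('a, 'f) alg \<Rightarrow> 'a rel set"
    and A :: "('a, 'f) alg"
  assumes "category_of_algebras \<tau> \<A>"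
    and "faithful_classes el \<tau> \<A>"
    and "congruences_presheaf el \<tau> \<A> \<K>"
    and "A \<in> \<A>"
  shows "CBS_property el \<tau> \<A> \<K> A \<longleftrightarrow>
    (\<forall>\<theta> \<in> \<K> A. isomorphic \<tau> A (quot el \<tau> A \<theta>) \<longrightarrow>
      (\<forall>\<sigma> \<in> \<K> A. \<sigma> \<subseteq> \<theta> \<longrightarrow> isomorphic \<tau> A (quot el \<tau> A \<sigma>)))"
proof -
  let ?Q = "\<lambda>A \<sigma>. quot el \<tau> A \<sigma>" and ?q = "qclass el"
  have alg: "algebra \<tau> B" if "B \<in> \<A>" for B
    using assms(1) that by (simp add: category_of_algebras_def)
  have el: "inj_on el (carrier B // \<sigma>)" if "B \<in> \<A>" "\<sigma> \<in> Con \<tau> B" for B \<sigma>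
    using assms(2) that by (simp add: faithful_classes_def)
  have op: "congruences_operator el \<tau> \<A> \<K>"
    using assms(3) by (simp add: congruences_presheaf_def)
  have K_Con: "\<sigma> \<in> Con \<tau> B" if "B \<in> \<A>" "\<sigma> \<in> \<K> B" for B \<sigma>
    using op that by (auto simp: congruences_operator_def)
  have Q: "?Q B \<sigma> \<in> \<A>" if "B \<in> \<A>" "\<sigma> \<in> \<K> B" for B \<sigma>
    using op that by (simp add: congruences_operator_def)
  have K_pullback: "pullback B f \<theta> \<in> \<K> B"
    if "B \<in> \<A>" "C \<in> \<A>" "f \<in> isos \<tau> B C" "\<theta> \<in> \<K> C" for B C f \<theta>
    using op that unfolding congruences_operator_def order_iso_def by (blast dest: bij_betwE)
  have presheaf: "\<theta> \<in> \<K> B \<longleftrightarrow> con_quot el \<theta> \<sigma> \<in> \<K> (?Q B \<sigma>)"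
    if "B \<in> \<A>" "\<sigma> \<in> \<K> B" "\<theta> \<in> Con \<tau> B" "\<sigma> \<subseteq> \<theta>" for B \<sigma> \<theta>
    using assms(3) that by (simp add: congruences_presheaf_def)
  have proj: "?q \<sigma> \<in> homs \<tau> B (?Q B \<sigma>)" if "B \<in> \<A>" "\<sigma> \<in> \<K> B" for B \<sigma>
    using qclass_hom alg el K_Con that by metis
  have q_eq: "?q \<sigma> x = ?q \<sigma> y \<longleftrightarrow> (x, y) \<in> \<sigma>"
    if "B \<in> \<A>" "\<sigma> \<in> \<K> B" "x \<in> carrier B" "y \<in> carrier B" for B \<sigma> x y
    using qclass_eq_iff el K_Con that by metis
  note A = \<open>A \<in> \<A>\<close>
  show ?thesis
  proof (intro iffI ballI impI)
    fix \<theta> \<sigma>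
    assume CBS: "CBS_property el \<tau> \<A> \<K> A"
      and \<theta>: "\<theta> \<in> \<K> A" and iso: "isomorphic \<tau> A (?Q A \<theta>)"
      and \<sigma>: "\<sigma> \<in> \<K> A" and sub: "\<sigma> \<subseteq> \<theta>"
    let ?B = "?Q A \<sigma>" and ?\<psi> = "con_quot el \<theta> \<sigma>"
    note B = Q[OF A \<sigma>]
    have \<psi>: "?\<psi> \<in> \<K> ?B"
      using presheaf[OF A \<sigma> K_Con[OF A \<theta>] sub] \<theta> by simp
    have "isomorphic \<tau> (?Q A \<theta>) (?Q ?B ?\<psi>)"
    proof (rule isomorphic_quot_image)
      show "?q ?\<psi> \<circ> ?q \<sigma> \<in> homs \<tau> A (?Q ?B ?\<psi>)"
        by (rule homs_comp[OF proj[OF A \<sigma>] proj[OF B \<psi>]])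
      show "(?q ?\<psi> \<circ> ?q \<sigma>) ` carrier A = carrier (?Q ?B ?\<psi>)"
        by (simp add: carrier_quot image_comp)
      show "(?q ?\<psi> \<circ> ?q \<sigma>) x = (?q ?\<psi> \<circ> ?q \<sigma>) y \<longleftrightarrow> (x, y) \<in> \<theta>"
        if "x \<in> carrier A" "y \<in> carrier A" for x y
        using that q_eq[OF B \<psi>, of "?q \<sigma> x" "?q \<sigma> y"]
          con_quot_iff[OF K_Con[OF A \<sigma>] el[OF A K_Con[OF A \<sigma>]] K_Con[OF A \<theta>] sub that]
        by (simp add: carrier_quot)
    qed (use alg el K_Con A \<theta> in auto)
    then have "isomorphic \<tau> A (?Q ?B ?\<psi>)"
      by (rule isomorphic_trans[OF iso])
    then show "isomorphic \<tau> A ?B"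
      using CBS B \<psi> \<sigma> isomorphic_refl[of \<tau> ?B] unfolding CBS_property_def by blast
  next
    assume cond: "\<forall>\<theta> \<in> \<K> A. isomorphic \<tau> A (?Q A \<theta>) \<longrightarrow>
      (\<forall>\<sigma> \<in> \<K> A. \<sigma> \<subseteq> \<theta> \<longrightarrow> isomorphic \<tau> A (?Q A \<sigma>))"
    have "isomorphic \<tau> A B"
      if B: "B \<in> \<A>" and \<theta>B: "\<theta>B \<in> \<K> B" and \<theta>A: "\<theta>A \<in> \<K> A"
        and AB: "isomorphic \<tau> A (?Q B \<theta>B)" and BA: "isomorphic \<tau> B (?Q A \<theta>A)" for B \<theta>B \<theta>A
    proof -
      note QA = Q[OF A \<theta>A]
      note \<theta>A_Con = K_Con[OF A \<theta>A]
      have QAB: "isomorphic \<tau> (?Q A \<theta>A) B"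
        by (rule isomorphic_sym[OF alg[OF B] BA])
      then obtain g where g: "g \<in> isos \<tau> (?Q A \<theta>A) B"
        by (auto simp: isomorphic_def)
      then have g_hom: "g \<in> homs \<tau> (?Q A \<theta>A) B"
        and g_onto: "g ` ?q \<theta>A ` carrier A = carrier B"
        by (auto simp: isos_def bij_betw_def carrier_quot)
      define \<psi> where "\<psi> = pullback (?Q A \<theta>A) g \<theta>B"
      define \<theta> where "\<theta> = pullback A (?q \<theta>A) \<psi>"
      have \<psi>: "\<psi> \<in> \<K> (?Q A \<theta>A)"
        unfolding \<psi>_def by (rule K_pullback[OF QA B g \<theta>B])
      note \<psi>_Con = K_Con[OF QA \<psi>]
      have \<theta>_Con: "\<theta> \<in> Con \<tau> A"
        unfolding \<theta>_def by (rule pullback_Con[OF proj[OF A \<theta>A] alg[OF A] \<psi>_Con])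
      have sub: "\<theta>A \<subseteq> \<theta>"
        unfolding \<theta>_def by (rule subset_pullback_qclass[OF \<theta>A_Con el[OF A \<theta>A_Con] \<psi>_Con])
      have "con_quot el \<theta> \<theta>A = \<psi>"
        unfolding \<theta>_def by (rule con_quot_pullback[OF \<psi>_Con])
      then have \<theta>: "\<theta> \<in> \<K> A"
        using presheaf[OF A \<theta>A \<theta>_Con sub] \<psi> by simp
      have "isomorphic \<tau> (?Q A \<theta>) (?Q B \<theta>B)"
      proof (rule isomorphic_quot_image[OF alg[OF A] \<theta>_Con el[OF A \<theta>_Con]])
        let ?h = "?q \<theta>B \<circ> (g \<circ> ?q \<theta>A)"
        have gq_hom: "g \<circ> ?q \<theta>A \<in> homs \<tau> A B"
          by (rule homs_comp[OF proj[OF A \<theta>A] g_hom])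
        show "?h \<in> homs \<tau> A (?Q B \<theta>B)"
          by (rule homs_comp[OF gq_hom proj[OF B \<theta>B]])
        show "?h ` carrier A = carrier (?Q B \<theta>B)"
          by (simp only: carrier_quot image_comp[symmetric] g_onto)
        show "?h x = ?h y \<longleftrightarrow> (x, y) \<in> \<theta>" if c: "x \<in> carrier A" "y \<in> carrier A" for x y
        proof -
          have "g (?q \<theta>A x) \<in> carrier B" "g (?q \<theta>A y) \<in> carrier B"
            using c g_onto by auto
          then show ?thesis
            using c q_eq[OF B \<theta>B] by (simp add: \<theta>_def \<psi>_def pullback_def carrier_quot)
        qed
      qed
      then have "isomorphic \<tau> (?Q A \<theta>) A"
        using isomorphic_trans isomorphic_sym[OF alg[OF A] AB] by blast
      then have "isomorphic \<tau> A (?Q A \<theta>)"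
        by (rule isomorphic_sym[OF alg[OF Q[OF A \<theta>]]])
      then have "isomorphic \<tau> A (?Q A \<theta>A)"
        using cond \<theta> \<theta>A sub by blast
      then show ?thesis
        using QAB by (rule isomorphic_trans)
    qed
    then show "CBS_property el \<tau> \<A> \<K> A"
      unfolding CBS_property_def by blast
  qed
qed

end
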